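(* Let $K$ be a field and $S=K[[x_1,\ldots,x_n]]$. For $i=1,\ldots,n$ let $J_i\subset K[[x_i,\ldots,x_n]]$ be an ideal, and let $J\subset S$ be the ideal generated by $\sum_{i=1}^n x_iJ_i$. Then $J^k$ is $d$-Golod for all $k\ge2$.
   Context: $\mathfrak{n}=(x_1,\ldots,x_n)\subset S$. For $f\in\mathfrak{n}$ and $1\le r\le n$ define $$d^r(f)=\frac{f(0,\ldots,0,x_r,\ldots,x_n)-f(0,\ldots,0,x_{r+1},\ldots,x_n)}{x_r}\in S.$$ For a proper ideal $I=(f_1,\ldots,f_m)$ of $S$, $d(I)$ is the ideal of $S$ generated by all $d^i(f_j)$, $1\le i\le n$, $1\le j\le m$ (independent of the choice of generators). The ideal $I$ is called $d$-Golod if $d(I)^2\subset I$. The ring $K[[x_i,\ldots,x_n]]$ is regarded as a subring of $S$. *)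

theory Defs
  imports "HOL-Algebra.Ideal_Product" "HOL-Library.Multiset"
begin

text \<open>
  A monomial in the variables \<open>x\<^sub>i\<close>, \<open>i :: nat\<close>, is the multiset of its variables:
  \<open>count m i\<close> is the exponent of \<open>x\<^sub>i\<close>, and the product of monomials is \<open>m + m'\<close>.
  A power series is its coefficient function. \<open>mps_ring V\<close> is the ring of power series over
  the field \<open>'k\<close> in the variables \<open>x\<^sub>i\<close> with \<open>i \<in> V\<close>; for \<open>V \<subseteq> W\<close> it is literally a
  subring of \<open>mps_ring W\<close>, so \<open>mps_ring {i..n}\<close> is \<open>K[[x\<^sub>i,\<dots>,x\<^sub>n]]\<close> as a subring
  of \<open>S = mps_ring {1..n}\<close>.
\<close>

type_synonym 'k mps = "nat multiset \<Rightarrow> 'k"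

definition mps_mult :: "'k::field mps \<Rightarrow> 'k mps \<Rightarrow> 'k mps" where
  "mps_mult f g = (\<lambda>m. \<Sum>(a, b) \<in> {(a, b). a + b = m}. f a * g b)"

definition mps_ring :: "nat set \<Rightarrow> 'k::field mps ring" where
  "mps_ring V =
    \<lparr>carrier = {f. \<forall>m. f m \<noteq> 0 \<longrightarrow> set_mset m \<subseteq> V},
     monoid.mult = mps_mult,
     one = (\<lambda>m. if m = {#} then 1 else 0),
     zero = (\<lambda>m. 0),
     add = (\<lambda>f g m. f m + g m)\<rparr>"

definition mps_var :: "nat \<Rightarrow> 'k::field mps" where
  "mps_var i = (\<lambda>m. if m = {#i#} then 1 else 0)"

text \<open>\<open>mps_kill r f\<close> is \<open>f(0,\<dots>,0,x\<^sub>r,\<dots>,x\<^sub>n)\<close>: setting variables to zero discards exactly the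
  monomials in which one of them occurs.\<close>

definition mps_kill :: "nat \<Rightarrow> 'k::field mps \<Rightarrow> 'k mps" where
  "mps_kill r f = (\<lambda>m. if \<forall>i \<in># m. r \<le> i then f m else 0)"

text \<open>The quotient of \<open>g\<close> by \<open>x\<^sub>r\<close>, meaningful when \<open>x\<^sub>r\<close> divides \<open>g\<close>; in the definition
  of \<open>mps_d\<close> it does, see \<open>mps_var_mult_d\<close> below.\<close>

definition mps_div_var :: "nat \<Rightarrow> 'k::field mps \<Rightarrow> 'k mps" where
  "mps_div_var r g = (\<lambda>m. g (m + {#r#}))"

definition mps_d :: "nat \<Rightarrow> 'k::field mps \<Rightarrow> 'k mps" where
  "mps_d r f = mps_div_var r (\<lambda>m. mps_kill r f m - mps_kill (Suc r) f m)"

text \<open>The ideal \<open>d(I)\<close> of \<open>S\<close>, computed from a set \<open>F\<close> of generators of \<open>I\<close>.\<close>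

definition d_ideal :: "nat \<Rightarrow> 'k::field mps set \<Rightarrow> 'k mps set" where
  "d_ideal n F = genideal (mps_ring {1..n}) {mps_d r f |r f. r \<in> {1..n} \<and> f \<in> F}"

text \<open>Since \<open>d(I)\<close> does not depend on the generators (\<open>d_ideal_cong\<close> below), the condition
  is imposed for every generating set, finite or not. It is not vacuous, because \<open>F = I\<close>
  is always one of them.\<close>

definition d_Golod :: "nat \<Rightarrow> 'k::field mps set \<Rightarrow> bool" where
  "d_Golod n I \<longleftrightarrow>
    (let S = mps_ring {1..n} in
      ideal I S \<and> I \<noteq> carrier S \<and>
      (\<forall>F \<subseteq> carrier S. genideal S F = I \<longrightarrow> ideal_prod S (d_ideal n F) (d_ideal n F) \<subseteq> I))"


subsection \<open>The ring of power series\<close>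

lemma finite_mset_splits: "finite {(a, b). a + b = (m :: 'a multiset)}"
proof -
  have "finite {a. a \<subseteq># m}"
  proof (induction m)
    case (add x m)
    have "{a. a \<subseteq># add_mset x m} \<subseteq> {a. a \<subseteq># m} \<union> add_mset x ` {a. a \<subseteq># m}"
    proof
      fix a assume "a \<in> {a. a \<subseteq># add_mset x m}"
      then have a: "a \<subseteq># add_mset x m" by simp
      show "a \<in> {a. a \<subseteq># m} \<union> add_mset x ` {a. a \<subseteq># m}"
      proof (cases "x \<in># a")
        case True
        then obtain b where "a = add_mset x b" by (metis mset_add)
        then show ?thesis using a by auto
      next
        case False
        then show ?thesis using a
          by (metis UnI1 add_mset_remove_trivial diff_single_trivial mem_Collect_eq
              subset_eq_diff_conv add_mset_add_single)
      qed
    qed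
    then show ?case using add by (meson finite_UnI finite_imageI finite_subset)
  qed simp
  then have "finite ((\<lambda>a. (a, m - a)) ` {a. a \<subseteq># m})" by simp
  moreover have "{(a, b). a + b = m} \<subseteq> (\<lambda>a. (a, m - a)) ` {a. a \<subseteq># m}" by force
  ultimately show ?thesis by (rule finite_subset[rotated])
qed

lemma mps_mult_comm: "mps_mult f g = mps_mult g f"
proof
  fix m
  show "mps_mult f g m = mps_mult g f m"
    unfolding mps_mult_def
    by (rule sum.reindex_bij_witness[where i = prod.swap and j = prod.swap])
      (auto simp: ac_simps)
qed

lemma mps_mult_assoc: "mps_mult (mps_mult f g) h = mps_mult f (mps_mult g h)"
proof
  fix m
  have "mps_mult (mps_mult f g) h m =
      (\<Sum>(p, c) \<in> {(p, c). p + c = m}. \<Sum>(a, b) \<in> {(a, b). a + b = p}. f a * g b * h c)"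
    by (simp add: mps_mult_def sum_distrib_right case_prod_beta)
  also have "\<dots> = (\<Sum>((p, c), (a, b)) \<in> (SIGMA pc:{(p, c). p + c = m}. {(a, b). a + b = fst pc}).
      f a * g b * h c)"
    by (subst sum.Sigma[symmetric]) (auto simp: finite_mset_splits case_prod_beta)
  also have "\<dots> = (\<Sum>((a, q), (b, c)) \<in> (SIGMA aq:{(a, q). a + q = m}. {(b, c). b + c = snd aq}).
      f a * (g b * h c))"
    by (rule sum.reindex_bij_witness[where
          i = "\<lambda>((a, q), (b, c)). ((a + b, c), (a, b))" and
          j = "\<lambda>((p, c), (a, b)). ((a, b + c), (b, c))"])
      (auto simp: ac_simps)
  also have "\<dots> = (\<Sum>(a, q) \<in> {(a, q). a + q = m}. \<Sum>(b, c) \<in> {(b, c). b + c = q}.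
      f a * (g b * h c))"
    by (subst sum.Sigma[symmetric]) (auto simp: finite_mset_splits case_prod_beta)
  also have "\<dots> = mps_mult f (mps_mult g h) m"
    by (simp add: mps_mult_def sum_distrib_left case_prod_beta)
  finally show "mps_mult (mps_mult f g) h m = mps_mult f (mps_mult g h) m" .
qed

lemma mps_mult_left_commute: "mps_mult f (mps_mult g h) = mps_mult g (mps_mult f h)"
  by (simp add: mps_mult_assoc[symmetric] mps_mult_comm[of f g])

lemma mps_mult_one: "mps_mult (\<lambda>m. if m = {#} then 1 else 0) f = f"
proof
  fix m
  define e where "e = (\<lambda>m :: nat multiset. if m = {#} then 1 else 0 :: 'a)"
  have "mps_mult e f m = (\<Sum>(a, b) \<in> {({#}, m)}. e a * f b)"
    unfolding mps_mult_def
    by (intro sum.mono_neutral_right) (auto simp: finite_mset_splits e_def split: if_splits)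
  then show "mps_mult (\<lambda>m. if m = {#} then 1 else 0) f m = f m" by (simp add: e_def)
qed

lemma mps_mult_var: "mps_mult (mps_var r) f m = (if r \<in># m then f (m - {#r#}) else 0)"
proof (cases "r \<in># m")
  case True
  have "mps_mult (mps_var r) f m = (\<Sum>(a, b) \<in> {({#r#}, m - {#r#})}. mps_var r a * f b)"
    unfolding mps_mult_def using True
    by (intro sum.mono_neutral_right) (auto simp: finite_mset_splits mps_var_def split: if_splits)
  then show ?thesis using True by (simp add: mps_var_def)
next
  case False
  then have "mps_mult (mps_var r) f m = 0"
    unfolding mps_mult_def by (intro sum.neutral) (auto simp: mps_var_def)
  then show ?thesis using False by simp
qed

lemma mps_ring_ops:
  "\<zero>\<^bsub>mps_ring V\<^esub> = (\<lambda>m. 0)"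
  "f \<oplus>\<^bsub>mps_ring V\<^esub> g = (\<lambda>m. f m + g m)"
  "f \<otimes>\<^bsub>mps_ring V\<^esub> g = mps_mult f g"
  by (simp_all add: mps_ring_def)

lemma mps_mult_closed:
  assumes "f \<in> carrier (mps_ring V)" "g \<in> carrier (mps_ring V)"
  shows "mps_mult f g \<in> carrier (mps_ring V)"
proof -
  have "set_mset m \<subseteq> V" if nz: "mps_mult f g m \<noteq> 0" for m
  proof -
    obtain a b where "a + b = m" "f a * g b \<noteq> 0"
      using nz unfolding mps_mult_def by (auto elim!: sum.not_neutral_contains_not_neutral)
    then have "set_mset a \<subseteq> V" "set_mset b \<subseteq> V"
      using assms by (auto simp: mps_ring_def)
    then show ?thesis using \<open>a + b = m\<close> by auto
  qed
  then show ?thesis by (simp add: mps_ring_def)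
qed

lemma cring_mps_ring: "cring (mps_ring V :: 'k::field mps ring)"
proof (rule cringI)
  show "abelian_group (mps_ring V :: 'k mps ring)"
  proof (rule abelian_groupI)
    fix f :: "'k mps" assume "f \<in> carrier (mps_ring V)"
    then show "\<exists>g \<in> carrier (mps_ring V). g \<oplus>\<^bsub>mps_ring V\<^esub> f = \<zero>\<^bsub>mps_ring V\<^esub>"
      by (intro bexI[of _ "\<lambda>m. - f m"]) (auto simp: mps_ring_def)
  qed (auto simp: mps_ring_def add_ac, (metis add.right_neutral subsetD)+)
  show "Group.comm_monoid (mps_ring V :: 'k mps ring)"
  proof (rule comm_monoidI)
    fix f g :: "'k mps"
    assume "f \<in> carrier (mps_ring V)" "g \<in> carrier (mps_ring V)"
    then show "f \<otimes>\<^bsub>mps_ring V\<^esub> g \<in> carrier (mps_ring V)"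
      using mps_mult_closed by (simp add: mps_ring_def)
  qed (auto simp: mps_ring_def mps_mult_assoc mps_mult_one intro: mps_mult_comm)
  fix f g h :: "'k mps"
  show "(f \<oplus>\<^bsub>mps_ring V\<^esub> g) \<otimes>\<^bsub>mps_ring V\<^esub> h
      = f \<otimes>\<^bsub>mps_ring V\<^esub> h \<oplus>\<^bsub>mps_ring V\<^esub> g \<otimes>\<^bsub>mps_ring V\<^esub> h"
    by (auto simp: mps_ring_def mps_mult_def algebra_simps sum.distrib case_prod_beta)
qed

lemma mps_var_mult_d:
  "mps_mult (mps_var r) (mps_d r f) = (\<lambda>m. mps_kill r f m - mps_kill (Suc r) f m)"
proof
  fix m
  show "mps_mult (mps_var r) (mps_d r f) m = mps_kill r f m - mps_kill (Suc r) f m"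
  proof (cases "r \<in># m")
    case True
    then show ?thesis by (simp add: mps_mult_var mps_d_def mps_div_var_def)
  next
    case False
    then have "(\<forall>i \<in># m. r \<le> i) \<longleftrightarrow> (\<forall>i \<in># m. Suc r \<le> i)"
      by (metis Suc_leD le_antisym not_less_eq_eq)
    then show ?thesis using False by (simp add: mps_mult_var mps_kill_def)
  qed
qed


subsection \<open>Independence of the generators\<close>

lemma mps_kill_mult: "mps_kill r (mps_mult f g) = mps_mult (mps_kill r f) (mps_kill r g)"
proof
  fix m
  show "mps_kill r (mps_mult f g) m = mps_mult (mps_kill r f) (mps_kill r g) m"
  proof (cases "\<forall>i \<in># m. r \<le> i")
    case True
    then show ?thesis by (auto simp: mps_kill_def mps_mult_def intro!: sum.cong)
  next
    case False
    then have "mps_mult (mps_kill r f) (mps_kill r g) m = 0"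
      unfolding mps_mult_def by (intro sum.neutral) (auto simp: mps_kill_def)
    then show ?thesis using False by (auto simp: mps_kill_def)
  qed
qed

lemma mps_div_var_mult: "mps_div_var r (mps_mult (mps_var r) f) = f"
  by (rule ext) (simp add: mps_div_var_def mps_mult_var)

lemma mps_mult_add: "mps_mult f (\<lambda>m. g m + h m) = (\<lambda>m. mps_mult f g m + mps_mult f h m)"
  by (rule ext) (simp add: mps_mult_def algebra_simps sum.distrib case_prod_beta)

lemma mps_mult_diff: "mps_mult f (\<lambda>m. g m - h m) = (\<lambda>m. mps_mult f g m - mps_mult f h m)"
  by (rule ext) (simp add: mps_mult_def algebra_simps sum_subtractf case_prod_beta)

lemma mps_d_mult:
  "mps_d r (mps_mult f g) =
    (\<lambda>m. mps_mult (mps_kill r g) (mps_d r f) m + mps_mult (mps_kill (Suc r) f) (mps_d r g) m)"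
    (is "_ = ?h")
proof -
  have "mps_mult (mps_var r) ?h = (\<lambda>m.
      mps_mult (mps_kill r g) (mps_mult (mps_var r) (mps_d r f)) m +
      mps_mult (mps_kill (Suc r) f) (mps_mult (mps_var r) (mps_d r g)) m)"
    unfolding mps_mult_add by (simp only: mps_mult_left_commute[of "mps_var r"])
  also have "\<dots> = (\<lambda>m. mps_kill r (mps_mult f g) m - mps_kill (Suc r) (mps_mult f g) m)"
    unfolding mps_var_mult_d mps_mult_diff mps_kill_mult
    by (simp add: mps_mult_comm[of "mps_kill r g"])
  finally have "mps_div_var r (mps_mult (mps_var r) ?h) = mps_d r (mps_mult f g)"
    by (simp only: mps_d_def)
  then show ?thesis by (simp only: mps_div_var_mult)
qed

lemma mps_kill_closed:
  "f \<in> carrier (mps_ring V) \<Longrightarrow> mps_kill r f \<in> carrier (mps_ring V)"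
  by (auto simp: mps_ring_def mps_kill_def)

lemma mps_d_closed:
  "f \<in> carrier (mps_ring V) \<Longrightarrow> mps_d r f \<in> carrier (mps_ring V)"
  by (fastforce simp: mps_ring_def mps_kill_def mps_d_def mps_div_var_def split: if_splits)

lemma mps_var_closed: "r \<in> V \<Longrightarrow> mps_var r \<in> carrier (mps_ring V)"
  by (auto simp: mps_ring_def mps_var_def split: if_splits)

lemma mps_kill_mem_ideal:
  assumes D: "ideal D (mps_ring {1..n})"
    and g: "g \<in> carrier (mps_ring {1..n})" "g {#} = 0"
    and d: "\<forall>r \<in> {1..n}. mps_d r g \<in> D"
    and r: "1 \<le> r" "r \<le> Suc n"
  shows "mps_kill r g \<in> D"
  using r(2,1)
proof (induction r rule: inc_induct)
  case base
  have "mps_kill (Suc n) g m = 0" for m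
  proof (rule ccontr)
    assume "mps_kill (Suc n) g m \<noteq> 0"
    then have "\<forall>i \<in># m. Suc n \<le> i" "g m \<noteq> 0"
      by (auto simp: mps_kill_def split: if_splits)
    moreover from this(2) have "set_mset m \<subseteq> {1..n}" using g(1) by (auto simp: mps_ring_def)
    ultimately have "m = {#}" by (metis atLeastAtMost_iff multiset_nonemptyE not_less_eq_eq subsetD)
    then show False using g(2) \<open>g m \<noteq> 0\<close> by simp
  qed
  then have "mps_kill (Suc n) g = \<zero>\<^bsub>mps_ring {1..n}\<^esub>" by (auto simp: mps_ring_def)
  then show ?case
    using D by (simp add: ideal_def additive_subgroup.zero_closed)
next
  case (step r)
  have "mps_var r \<otimes>\<^bsub>mps_ring {1..n}\<^esub> mps_d r g \<in> D"
    using step d by (intro ideal.I_l_closed[OF D] mps_var_closed) auto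
  moreover have "mps_kill (Suc r) g \<in> D" using step by simp
  ultimately have
    "mps_var r \<otimes>\<^bsub>mps_ring {1..n}\<^esub> mps_d r g \<oplus>\<^bsub>mps_ring {1..n}\<^esub> mps_kill (Suc r) g \<in> D"
    using D by (simp add: ideal_def additive_subgroup.a_closed)
  then show ?case by (simp add: mps_ring_def mps_var_mult_d)
qed

lemma d_ideal_genideal:
  assumes F: "F \<subseteq> carrier (mps_ring {1..n})" "\<forall>f \<in> F. f {#} = (0 :: 'k::field)"
  shows "d_ideal n (genideal (mps_ring {1..n}) F) = d_ideal n F"
proof -
  let ?S = "mps_ring {1..n} :: 'k mps ring"
  interpret S: cring ?S by (rule cring_mps_ring)
  let ?gens = "\<lambda>F :: 'k mps set. {mps_d r f |r f. r \<in> {1..n} \<and> f \<in> F}"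
  have gens: "?gens G \<subseteq> carrier ?S" if "G \<subseteq> carrier ?S" for G
    using that mps_d_closed by blast
  let ?D = "d_ideal n F"
  have D: "ideal ?D ?S"
    unfolding d_ideal_def by (rule S.genideal_ideal[OF gens[OF F(1)]])
  interpret D: ideal ?D ?S by (rule D)
  define A where "A = {g \<in> carrier ?S. g {#} = 0 \<and> (\<forall>r \<in> {1..n}. mps_d r g \<in> ?D)}"
  have mult_A: "mps_mult g s \<in> A" if g: "g \<in> A" and s: "s \<in> carrier ?S" for g s
  proof -
    have "mps_d r (mps_mult g s) \<in> ?D" if r: "r \<in> {1..n}" for r
    proof -
      have "mps_kill r s \<otimes>\<^bsub>?S\<^esub> mps_d r g \<in> ?D"
        using g s r by (intro D.I_l_closed mps_kill_closed) (auto simp: A_def)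
      moreover have "mps_kill (Suc r) g \<otimes>\<^bsub>?S\<^esub> mps_d r s \<in> ?D"
        using g s r
        by (intro D.I_r_closed mps_d_closed mps_kill_mem_ideal[OF D]) (auto simp: A_def)
      ultimately have "mps_kill r s \<otimes>\<^bsub>?S\<^esub> mps_d r g \<oplus>\<^bsub>?S\<^esub>
          mps_kill (Suc r) g \<otimes>\<^bsub>?S\<^esub> mps_d r s \<in> ?D"
        by (rule D.a_closed)
      then show ?thesis by (simp only: mps_d_mult mps_ring_ops)
    qed
    moreover have "mps_mult g s \<in> carrier ?S"
      using g s by (intro mps_mult_closed) (auto simp: A_def)
    moreover have "mps_mult g s {#} = 0"
      using g by (simp add: mps_mult_def A_def)
    ultimately show ?thesis by (simp add: A_def)
  qed
  have "ideal A ?S"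
  proof (rule idealI)
    show "ring ?S" by (rule S.ring_axioms)
    show "subgroup A (add_monoid ?S)"
    proof
      show "A \<subseteq> carrier (add_monoid ?S)" by (auto simp: A_def)
      have "mps_d r \<zero>\<^bsub>?S\<^esub> = \<zero>\<^bsub>?S\<^esub>" for r
        by (rule ext) (simp add: mps_d_def mps_div_var_def mps_kill_def mps_ring_ops)
      then have "\<zero>\<^bsub>?S\<^esub> \<in> A"
        using D.zero_closed S.zero_closed by (simp add: A_def mps_ring_ops del: One_nat_def)
      then show "\<one>\<^bsub>add_monoid ?S\<^esub> \<in> A" by simp
      fix f g assume f: "f \<in> A" and g: "g \<in> A"
      have "mps_d r (f \<oplus>\<^bsub>?S\<^esub> g) = mps_d r f \<oplus>\<^bsub>?S\<^esub> mps_d r g" for r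
        by (rule ext) (simp add: mps_d_def mps_div_var_def mps_kill_def mps_ring_ops)
      moreover have "(f \<oplus>\<^bsub>?S\<^esub> g) {#} = 0"
        using f g by (simp add: A_def mps_ring_ops)
      ultimately have "f \<oplus>\<^bsub>?S\<^esub> g \<in> A"
        using f g D.a_closed S.a_closed by (simp add: A_def del: One_nat_def)
      then show "f \<otimes>\<^bsub>add_monoid ?S\<^esub> g \<in> A" by simp
      have "(\<ominus>\<^bsub>?S\<^esub> \<one>\<^bsub>?S\<^esub>) \<in> carrier ?S"
        by (rule S.a_inv_closed[OF S.one_closed])
      from mult_A[OF f this] have "f \<otimes>\<^bsub>?S\<^esub> (\<ominus>\<^bsub>?S\<^esub> \<one>\<^bsub>?S\<^esub>) \<in> A"
        by (simp only: mps_ring_ops)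
      moreover have "f \<in> carrier ?S" using f unfolding A_def by blast
      ultimately have "\<ominus>\<^bsub>?S\<^esub> f \<in> A"
        by (simp add: S.r_minus del: One_nat_def)
      then show "inv\<^bsub>add_monoid ?S\<^esub> f \<in> A" by (simp add: a_inv_def)
    qed
    fix g s assume "g \<in> A" "s \<in> carrier ?S"
    then show "s \<otimes>\<^bsub>?S\<^esub> g \<in> A" "g \<otimes>\<^bsub>?S\<^esub> s \<in> A"
      using mult_A by (simp_all only: mps_ring_ops mps_mult_comm[of s g])
  qed
  moreover have "F \<subseteq> A"
    using F S.genideal_self[OF gens[OF F(1)]] unfolding A_def d_ideal_def by blast
  ultimately have "genideal ?S F \<subseteq> A" by (rule S.genideal_minimal)
  then have "?gens (genideal ?S F) \<subseteq> ?D" unfolding A_def by blast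
  then have "d_ideal n (genideal ?S F) \<subseteq> ?D"
    unfolding d_ideal_def[of n "genideal ?S F"] by (rule S.genideal_minimal[OF D])
  moreover have "?D \<subseteq> d_ideal n (genideal ?S F)"
  proof -
    have carr: "genideal ?S F \<subseteq> carrier ?S"
      using S.genideal_ideal[OF F(1)] by (meson ideal.Icarr subsetI)
    have "?gens F \<subseteq> ?gens (genideal ?S F)"
      using S.genideal_self[OF F(1)] by blast
    also have "\<dots> \<subseteq> d_ideal n (genideal ?S F)"
      unfolding d_ideal_def by (rule S.genideal_self[OF gens[OF carr]])
    finally show ?thesis
      unfolding d_ideal_def[of n F]
      using S.genideal_ideal[OF gens[OF carr]] by (intro S.genideal_minimal) (simp_all only: d_ideal_def)
  qed
  ultimately show ?thesis by (rule subset_antisym)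
qed

text \<open>Every proper ideal of \<open>S\<close> consists of series with constant coefficient \<open>0\<close>.\<close>

corollary d_ideal_cong:
  assumes "F \<subseteq> carrier (mps_ring {1..n})" "\<forall>f \<in> F. f {#} = (0 :: 'k::field)"
    and "G \<subseteq> carrier (mps_ring {1..n})" "\<forall>g \<in> G. g {#} = 0"
    and "genideal (mps_ring {1..n}) F = genideal (mps_ring {1..n}) G"
  shows "d_ideal n F = d_ideal n G"
  using d_ideal_genideal[of F n] d_ideal_genideal[of G n] assms by simp

end

theory Submission
  imports Defs "HOL-Algebra.QuotRing"
begin

text \<open>
  Setting \<open>x\<^sub>1, \<dots>, x\<^sub>r\<^sub>-\<^sub>1\<close> to zero maps \<open>x\<^sub>i g\<^sub>i\<close>, where \<open>g\<^sub>i \<in> J\<^sub>i\<close>, either to itself (\<open>r \<le> i\<close>)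
  or to \<open>0\<close> (\<open>i < r\<close>), so it maps \<open>J\<close> to itself. For any ideal \<open>I\<close> with this stability the
  twisted Leibniz rule for \<open>d\<^sup>r\<close> gives \<open>d(I\<^sup>k) \<subseteq> I\<^sup>k\<^sup>-\<^sup>1\<close> by induction on \<open>k\<close>, hence
  \<open>d(I\<^sup>k)\<^sup>2 \<subseteq> I\<^sup>2\<^sup>k\<^sup>-\<^sup>2 \<subseteq> I\<^sup>k\<close> as soon as \<open>k \<ge> 2\<close>.
\<close>

context cring
begin

text \<open>Ideals form a commutative monoid under \<open>ideal_prod\<close> with unit
  \<open>carrier R\<close>, so the laws of powers come from monoid theory and the zeroth power is
  the whole ring.\<close>

lemma ideals_set_pow_ideal:
  assumes "ideal I R"
  shows "ideal (I [^]\<^bsub>ideals_set R\<^esub> (k::nat)) R"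
  using monoid.nat_pow_closed[OF comm_monoid.axioms(1)[OF ideals_set_is_comm_monoid], of I k] assms
  by (simp add: ideals_set_def)

lemma ideals_set_pow_add:
  assumes "ideal I R"
  shows "ideal_prod R (I [^]\<^bsub>ideals_set R\<^esub> (k::nat)) (I [^]\<^bsub>ideals_set R\<^esub> l) = I [^]\<^bsub>ideals_set R\<^esub> (k + l)"
  using monoid.nat_pow_mult[OF comm_monoid.axioms(1)[OF ideals_set_is_comm_monoid], of I k l] assms
  by (simp add: ideals_set_def)

text \<open>The larger power is the product of the \<open>k\<close>-th and the
  \<open>(l - k)\<close>-th one, and a product of ideals lies in each factor.\<close>

lemma ideals_set_pow_antimono:
  assumes "ideal I R" "(k::nat) \<le> l"
  shows "I [^]\<^bsub>ideals_set R\<^esub> l \<subseteq> I [^]\<^bsub>ideals_set R\<^esub> k"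
  using ideals_set_pow_add[OF assms(1), of k "l - k"] assms
    ideal_prod_inter[OF ideals_set_pow_ideal[OF assms(1), of k] ideals_set_pow_ideal[OF assms(1), of "l - k"]]
  by auto

lemma ideals_set_pow_one:
  assumes "ideal I R"
  shows "I [^]\<^bsub>ideals_set R\<^esub> (1::nat) = I"
  using monoid.l_one[OF comm_monoid.axioms(1)[OF ideals_set_is_comm_monoid], of I] assms
  by (simp add: ideals_set_def)

end

lemma ideal_prod_mono:
  assumes "I \<subseteq> I'" "J \<subseteq> J'"
  shows "ideal_prod R I J \<subseteq> ideal_prod R I' J'"
proof
  fix s assume "s \<in> ideal_prod R I J"
  then show "s \<in> ideal_prod R I' J'"
    by induction (use assms in \<open>auto intro: ideal_prod.intros\<close>)
qed

lemma mps_kill_add: "mps_kill r (\<lambda>m. f m + g m) = (\<lambda>m. mps_kill r f m + mps_kill r g m)"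
  by (rule ext) (simp add: mps_kill_def)

lemma mps_d_add: "mps_d r (\<lambda>m. f m + g m) = (\<lambda>m. mps_d r f m + mps_d r g m)"
  by (rule ext) (simp add: mps_d_def mps_div_var_def mps_kill_def)

lemma ring_hom_cring_mps_kill:
  "ring_hom_cring (mps_ring V) (mps_ring V) (mps_kill r :: 'k::field mps \<Rightarrow> 'k mps)"
proof (intro ring_hom_cring.intro ring_hom_cring_axioms.intro cring_mps_ring ring_hom_memI)
  show "mps_kill r \<one>\<^bsub>mps_ring V\<^esub> = (\<one>\<^bsub>mps_ring V\<^esub> :: 'k mps)"
    by (auto simp: mps_ring_def mps_kill_def)
qed (simp_all only: mps_kill_closed mps_ring_ops mps_kill_mult mps_kill_add)

text \<open>Every monomial of \<open>g\<close> involves only variables of index at least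
  \<open>i\<close>, so none is discarded. This is how the containment of \<open>J i\<close> in
  \<open>mps_ring {i..n}\<close> enters.\<close>

lemma mps_kill_id:
  assumes "g \<in> carrier (mps_ring {i..n})" "r \<le> i"
  shows "mps_kill r g = g"
proof
  fix m
  show "mps_kill r g m = g m"
    using assms by (cases "g m = 0") (force simp: mps_kill_def mps_ring_def)+
qed

lemma mps_kill_var: "mps_kill r (mps_var i) = (if r \<le> i then mps_var i else (\<lambda>m. 0))"
  by (rule ext) (auto simp: mps_kill_def mps_var_def)

lemma mps_mult_zero: "mps_mult (\<lambda>m. 0) f = (\<lambda>m. 0)" "mps_mult f (\<lambda>m. 0) = (\<lambda>m. 0)"
  by (simp_all add: mps_mult_def fun_eq_iff)

lemma mps_ring_mono: "V \<subseteq> W \<Longrightarrow> carrier (mps_ring V) \<subseteq> carrier (mps_ring W)"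
  by (auto simp: mps_ring_def)

text \<open>Both claims go through one induction: for \<open>a\<close> in the \<open>k\<close>-th
  power and \<open>b\<close> in \<open>I\<close>, the twisted Leibniz rule \<open>mps_d_mult\<close>
  involves \<open>mps_kill r b\<close>, which stability puts in \<open>I\<close>, and
  \<open>mps_kill (Suc r) a\<close>, which the induction hypothesis puts in the \<open>k\<close>-th
  power.\<close>

lemma mps_kill_d_ideal_pow:
  fixes I :: "'k::field mps set" and k :: nat
  assumes I: "ideal I (mps_ring V)" and stable: "\<And>r f. f \<in> I \<Longrightarrow> mps_kill r f \<in> I"
    and f: "f \<in> I [^]\<^bsub>ideals_set (mps_ring V)\<^esub> k"
  shows "mps_kill r f \<in> I [^]\<^bsub>ideals_set (mps_ring V)\<^esub> k"
    and "mps_d r f \<in> I [^]\<^bsub>ideals_set (mps_ring V)\<^esub> (k - 1)"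
proof -
  let ?S = "mps_ring V :: 'k mps ring"
  interpret S: cring ?S by (rule cring_mps_ring)
  let ?P = "\<lambda>k::nat. I [^]\<^bsub>ideals_set ?S\<^esub> k"
  note P = S.ideals_set_pow_ideal[OF I]
  note P_add = additive_subgroup.a_closed[OF ideal.axioms(1)[OF P], unfolded mps_ring_ops]
  have "(\<forall>r. mps_kill r f \<in> ?P k) \<and> (\<forall>r. mps_d r f \<in> ?P (k - 1))"
    using f
  proof (induction k arbitrary: f)
    case 0
    \<comment> \<open>Since \<open>0 - 1 = 0\<close>, both memberships are in the unit ideal
      \<open>carrier ?S\<close>.\<close>
    then show ?case by (simp add: ideals_set_def mps_kill_closed mps_d_closed)
  next
    case (Suc k)
    have Psuc: "?P (Suc k) = ideal_prod ?S (?P k) I" by (simp add: ideals_set_def)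
    have "f \<in> ideal_prod ?S (?P k) I" using Suc.prems by (simp only: Psuc)
    then show ?case
    proof (induction f)
      case (prod a b)
      have d: "mps_d r (mps_mult a b) \<in> ?P k" for r
      proof -
        have kb: "mps_kill r b \<in> I" using prod stable by blast
        have "mps_mult (mps_kill r b) (mps_d r a) \<in> ?P k"
        \<comment> \<open>The factor from \<open>I\<close> raises the exponent \<open>k - 1\<close>
          of \<open>mps_d r a\<close> back to \<open>k\<close>. For \<open>k = 0\<close> the
          subtraction truncates, but then the target is the whole ring.\<close>
        proof (cases k)
          case 0
          then show ?thesis
            using kb ideal.Icarr[OF I] ideal.Icarr[OF P] Suc.IH[OF prod(1)]
            by (simp add: ideals_set_def mps_mult_closed)
        next
          case (Suc l)
          have "mps_mult (mps_d r a) (mps_kill r b) \<in> ideal_prod ?S (?P l) I"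
            using Suc.IH[OF prod(1)] kb Suc ideal_prod.prod[of "mps_d r a" "?P l" "mps_kill r b" I ?S]
            by (simp add: mps_ring_ops)
          then show ?thesis by (simp add: Suc ideals_set_def mps_mult_comm)
        qed
        \<comment> \<open>Here \<open>mps_d r b\<close> is merely some element of the ring; the
          other factor carries the membership.\<close>
        moreover have "mps_mult (mps_kill (Suc r) a) (mps_d r b) \<in> ?P k"
          using ideal.I_r_closed[OF P[of k], of "mps_kill (Suc r) a" "mps_d r b"]
            Suc.IH[OF prod(1)] ideal.Icarr[OF I prod(2)]
          by (simp add: mps_d_closed mps_ring_ops)
        ultimately show ?thesis unfolding mps_d_mult by (rule P_add)
      qed
      moreover have "mps_kill r (mps_mult a b) \<in> ?P (Suc k)" for r
        unfolding Psuc mps_kill_mult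
        using ideal_prod.prod[of "mps_kill r a" "?P k" "mps_kill r b" I ?S]
          Suc.IH[OF prod(1)] stable[OF prod(2)]
        by (simp add: mps_ring_ops)
      ultimately show ?case by (simp add: mps_ring_ops)
    next
      case (sum a b)
      then show ?case
        using P_add[of _ "Suc k"] P_add[of _ k] by (simp add: mps_ring_ops mps_kill_add mps_d_add)
    qed
  qed
  then show "mps_kill r f \<in> ?P k" "mps_d r f \<in> ?P (k - 1)" by blast+
qed

text \<open>Stability can be tested on generators, because the preimage of an ideal under the ring
  homomorphism \<open>mps_kill r\<close> is again an ideal.\<close>

lemma mps_kill_stable_genideal:
  fixes G :: "'k::field mps set"
  assumes G: "G \<subseteq> carrier (mps_ring V)"
    and kill: "\<And>g. g \<in> G \<Longrightarrow> mps_kill r g \<in> genideal (mps_ring V) G"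
    and f: "f \<in> genideal (mps_ring V) G"
  shows "mps_kill r f \<in> genideal (mps_ring V) G"
proof -
  let ?S = "mps_ring V :: 'k mps ring"
  interpret hom: ring_hom_cring ?S ?S "mps_kill r" by (rule ring_hom_cring_mps_kill)
  have "ideal {f \<in> carrier ?S. mps_kill r f \<in> genideal ?S G} ?S"
    by (rule ring_hom_ring.ideal_vimage[OF hom.ring.ring_hom_ring_axioms hom.R.genideal_ideal[OF G]])
  then have "genideal ?S G \<subseteq> {f \<in> carrier ?S. mps_kill r f \<in> genideal ?S G}"
    using G kill by (intro hom.R.genideal_minimal) auto
  then show ?thesis using f by blast
qed

lemma d_Golod_pow:
  fixes I :: "'k::field mps set" and k :: nat
  assumes I: "ideal I (mps_ring {1..n})" "I \<noteq> carrier (mps_ring {1..n})"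
    and stable: "\<And>r f. f \<in> I \<Longrightarrow> mps_kill r f \<in> I" and k: "2 \<le> k"
  shows "d_Golod n (I [^]\<^bsub>ideals_set (mps_ring {1..n})\<^esub> k)"
proof -
  let ?S = "mps_ring {1..n} :: 'k mps ring"
  interpret S: cring ?S by (rule cring_mps_ring)
  let ?P = "\<lambda>k::nat. I [^]\<^bsub>ideals_set ?S\<^esub> k"
  note P = S.ideals_set_pow_ideal[OF I(1)]
  have "?P k \<subseteq> I"
    using S.ideals_set_pow_antimono[OF I(1), of 1 k] S.ideals_set_pow_one[OF I(1)] k by simp
  then have proper: "?P k \<noteq> carrier ?S" using I ideal.Icarr[OF I(1)] by blast
  have "ideal_prod ?S (d_ideal n F) (d_ideal n F) \<subseteq> ?P k"
    if F: "F \<subseteq> carrier ?S" "genideal ?S F = ?P k" for F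
  proof -
    have "F \<subseteq> ?P k" using S.genideal_self[OF F(1)] F(2) by simp
    \<comment> \<open>The bound on \<open>mps_d\<close> holds for every element of the
      \<open>k\<close>-th power, so it covers an arbitrary generating set \<open>F\<close>.\<close>
    then have D: "d_ideal n F \<subseteq> ?P (k - 1)"
      unfolding d_ideal_def using mps_kill_d_ideal_pow(2)[OF I(1) stable]
      by (intro S.genideal_minimal P) auto
    have "ideal_prod ?S (d_ideal n F) (d_ideal n F) \<subseteq> ideal_prod ?S (?P (k - 1)) (?P (k - 1))"
      by (rule ideal_prod_mono[OF D D])
    also have "\<dots> = ?P (k - 1 + (k - 1))" by (rule S.ideals_set_pow_add[OF I(1)])
    \<comment> \<open>The inequality \<open>k \<le> 2 * (k - 1)\<close> is exactly where
      \<open>2 \<le> k\<close> enters.\<close>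
    also have "\<dots> \<subseteq> ?P k" using k by (intro S.ideals_set_pow_antimono[OF I(1)]) simp
    finally show ?thesis .
  qed
  then show ?thesis using P[of k] proper by (simp add: d_Golod_def Let_def)
qed

text \<open>By \<open>d_Golod_pow\<close> it remains to see that the generated ideal is stable under
  every \<open>mps_kill r\<close> and proper; both are read off from the generating sums.\<close>

theorem proposition3p4:
  fixes n :: nat and J :: "nat \<Rightarrow> 'k::field mps set" and k :: nat
  defines "S \<equiv> mps_ring {1..n}"
  assumes "\<forall>i \<in> {1..n}. ideal (J i) (mps_ring {i..n})"
    and "2 \<le> k"
  shows "d_Golod n
    (genideal S {\<Oplus>\<^bsub>S\<^esub>i \<in> {1..n}. mps_var i \<otimes>\<^bsub>S\<^esub> g i |g. \<forall>i \<in> {1..n}. g i \<in> J i}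
      [^]\<^bsub>ideals_set S\<^esub> k)"
proof -
  interpret S: cring S unfolding S_def by (rule cring_mps_ring)
  let ?comb = "\<lambda>g. \<Oplus>\<^bsub>S\<^esub>i \<in> {1..n}. mps_var i \<otimes>\<^bsub>S\<^esub> g i"
  define G where "G = {?comb g |g. \<forall>i \<in> {1..n}. g i \<in> J i}"
  have Jcarr: "g \<in> carrier (mps_ring {i..n})" "g \<in> carrier S"
    if "i \<in> {1..n}" "g \<in> J i" for i g
    using that assms(2) ideal.Icarr[of "J i" "mps_ring {i..n}" g] mps_ring_mono[of "{i..n}" "{1..n}"]
    by (auto simp: S_def)
  have term_carr: "mps_var i \<otimes>\<^bsub>S\<^esub> g i \<in> carrier S" if "i \<in> {1..n}" "g i \<in> J i" for i g
    using that Jcarr(2) mps_var_closed[of i "{1..n}"] by (intro S.m_closed) (auto simp: S_def)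
  have G: "G \<subseteq> carrier S"
    unfolding G_def using term_carr by (auto intro!: S.finsum_closed)
  have kill_comb: "mps_kill r (?comb g) = ?comb (\<lambda>i. if r \<le> i then g i else (\<lambda>m. 0))"
    if g: "\<forall>i \<in> {1..n}. g i \<in> J i" for r g
  proof -
    interpret hom: ring_hom_cring S S "mps_kill r"
      unfolding S_def by (rule ring_hom_cring_mps_kill)
    \<comment> \<open>For \<open>r \<le> i\<close> both factors are fixed. For \<open>i < r\<close>
      the variable itself becomes 0, so its cofactor may be replaced by 0.\<close>
    have kill_term: "mps_kill r (mps_var i \<otimes>\<^bsub>S\<^esub> g i) =
        mps_var i \<otimes>\<^bsub>S\<^esub> (if r \<le> i then g i else (\<lambda>m. 0))" if "i \<in> {1..n}" for i
      using mps_kill_id[OF Jcarr(1), of i "g i" r] that g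
      by (simp add: S_def mps_ring_ops mps_kill_mult mps_kill_var mps_mult_zero)
    have "mps_kill r (?comb g) = (\<Oplus>\<^bsub>S\<^esub>i \<in> {1..n}. mps_kill r (mps_var i \<otimes>\<^bsub>S\<^esub> g i))"
      using g term_carr by (subst hom.hom_finsum) (auto simp: o_def)
    also have "\<dots> = ?comb (\<lambda>i. if r \<le> i then g i else (\<lambda>m. 0))"
      using g term_carr kill_term by (intro S.finsum_cong') (auto simp flip: kill_term)
    finally show ?thesis .
  qed
  \<comment> \<open>This keeps the truncated family of cofactors inside the \<open>J i\<close>, so
    \<open>G\<close> itself is stable.\<close>
  have J0: "(\<lambda>m. 0) \<in> J i" if "i \<in> {1..n}" for i
    using that assms(2) additive_subgroup.zero_closed[OF ideal.axioms(1), of "J i" "mps_ring {i..n}"]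
    by (simp add: mps_ring_ops)
  have "mps_kill r f \<in> G" if f: "f \<in> G" for r f
  proof -
    obtain g where g: "\<forall>i \<in> {1..n}. g i \<in> J i" "f = ?comb g" using f by (auto simp: G_def)
    then have "\<forall>i \<in> {1..n}. (if r \<le> i then g i else (\<lambda>m. 0)) \<in> J i" using J0 by simp
    then show ?thesis
      unfolding G_def g(2) kill_comb[OF g(1)]
      by (intro CollectI exI[of _ "\<lambda>i. if r \<le> i then g i else (\<lambda>m. 0)"]) simp
  qed
  then have stable: "mps_kill r f \<in> genideal S G" if "f \<in> genideal S G" for r f
    using that G S.genideal_self[OF G] unfolding S_def by (blast intro: mps_kill_stable_genideal)
  \<comment> \<open>On \<open>S\<close>, \<open>mps_kill (Suc n)\<close> sets all variables to zero.
    Its kernel is an ideal containing \<open>G\<close>, but it fixes the unit.\<close>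
  have "genideal S G \<noteq> carrier S"
  proof
    interpret hom: ring_hom_cring S S "mps_kill (Suc n)"
      unfolding S_def by (rule ring_hom_cring_mps_kill)
    have "mps_kill (Suc n) f = \<zero>\<^bsub>S\<^esub>" if f: "f \<in> G" for f
    proof -
      obtain g where g: "\<forall>i \<in> {1..n}. g i \<in> J i" "f = ?comb g" using f by (auto simp: G_def)
      show ?thesis
        unfolding g(2) kill_comb[OF g(1)]
        by (intro S.add.finprod_one_eqI) (auto simp: S_def mps_ring_ops mps_mult_zero)
    qed
    then have "G \<subseteq> a_kernel S S (mps_kill (Suc n))"
      using G unfolding a_kernel_def' by blast
    then have "genideal S G \<subseteq> a_kernel S S (mps_kill (Suc n))"
      by (intro S.genideal_minimal ring_hom_ring.kernel_is_ideal hom.ring.ring_hom_ring_axioms)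
    moreover assume "genideal S G = carrier S"
    ultimately have "mps_kill (Suc n) \<one>\<^bsub>S\<^esub> = \<zero>\<^bsub>S\<^esub>"
      using S.one_closed unfolding a_kernel_def' by blast
    then have "\<one>\<^bsub>S\<^esub> {#} = \<zero>\<^bsub>S\<^esub> {#}" by simp
    then show False by (simp add: S_def mps_ring_def)
  qed
  then have "d_Golod n (genideal S G [^]\<^bsub>ideals_set S\<^esub> k)"
    using d_Golod_pow[of "genideal S G" n k] S.genideal_ideal[OF G] stable \<open>2 \<le> k\<close>
    unfolding S_def by simp
  then show ?thesis unfolding G_def .
qed

end
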